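(* Let $Q^T\tau$ be a system of estimable functions, where $Q$ is a $v\times s$ matrix with $\mathcal{C}(Q)\subseteq\mathcal{E}$, let $W_Q=QQ^T$ be the corresponding weight matrix, and let $\xi$ be a feasible design for $Q^T\tau$. Then the information matrix $N_Q(\xi)=(Q^TC^-(\xi)Q)^+$ for $Q^T\tau$ and the weighted information matrix $C_{W_Q}(\xi)=(K_{W_Q}^TC^-(\xi)K_{W_Q})^{-1}$ have the same non-zero eigenvalues, including multiplicities.
   Context: Consider the linear model $y=X(\xi)\tau+L\beta+\varepsilon$, where $y\in\mathbb{R}^n$ is the response, $\tau\in\mathbb{R}^v$ is the vector of parameters of interest, $\beta\in\mathbb{R}^m$ is the vector of nuisance parameters, $\varepsilon$ satisfies $E(\varepsilon)=0$ and $\mathrm{Var}(\varepsilon)=I_n$, the design $\xi$ determines the matrix $X(\xi)$, and $L$ does not depend on $\xi$. The information matrix of $\xi$ for $\tau$ is the $v\times v$ non-negative definite matrix $C(\xi)=X^T(\xi)(I-P_L)X(\xi)$, where $P_L=L(L^TL)^-L^T$ is the orthogonal projector on the column space of $L$. Write $\mathcal{C}(A)$ for the column space of $A$, $A^+$ for the Moore-Penrose inverse, and $A^-$ for any generalized inverse ($AA^-A=A$). A function $q^T\tau$ is estimable under $\xi$ iff $q\in\mathcal{C}(C(\xi))$. Standing assumption: all competing designs $\xi$ have the same estimation space, i.e. there is a fixed subspace $\mathcal{E}\subseteq\mathbb{R}^v$ with $\mathcal{C}(C(\xi))=\mathcal{E}$ for every $\xi$. A design $\xi$ is feasible for $Q^T\tau$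 if $\mathcal{C}(Q)\subseteq\mathcal{C}(C(\xi))$. A weight matrix is a $v\times v$ symmetric non-negative definite matrix $W$ with $\mathcal{C}(W)\subseteq\mathcal{E}$. For a weight matrix $W$ of rank $d$ with spectral decomposition $W=S_W\Lambda_WS_W^T$, $\Lambda_W=\mathrm{diag}(\lambda_1(W),\ldots,\lambda_v(W))$ with $\lambda_1(W)\ge\ldots\ge\lambda_v(W)$ and $S_W$ orthogonal, put $K_W=FD^{1/2}$, where $D=\mathrm{diag}(\lambda_1(W),\ldots,\lambda_d(W))$ and $F$ consists of the first $d$ columns of $S_W$. Thus $K_W$ is a $v\times d$ matrix of rank $d$ with $K_WK_W^T=W$. If $\mathcal{C}(W)\subseteq\mathcal{C}(C(\xi))$, the weighted information matrix $C_W(\xi)=(K_W^TC^-(\xi)K_W)^{-1}$ is a well-defined $d\times d$ matrix. The expressions $Q^TC^-(\xi)Q$ and $K_W^TC^-(\xi)K_W$ do not depend on the choice of generalized inverse. *)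

theory Defs
  imports
    "Jordan_Normal_Form.DL_Rank"
    "Jordan_Normal_Form.Char_Poly"
    "Jordan_Normal_Form.Gauss_Jordan_Elimination"
begin

abbreviation column_space :: "real mat \<Rightarrow> real vec set" where
  "column_space A \<equiv> vec_space.col_space (dim_row A) A"

definition is_ginv :: "real mat \<Rightarrow> real mat \<Rightarrow> bool" where
  "is_ginv A G \<longleftrightarrow> G \<in> carrier_mat (dim_col A) (dim_row A) \<and> A * G * A = A"

definition is_mp_inverse :: "real mat \<Rightarrow> real mat \<Rightarrow> bool" where
  "is_mp_inverse A G \<longleftrightarrow> G \<in> carrier_mat (dim_col A) (dim_row A) \<and>
     A * G * A = A \<and> G * A * G = G \<and> (A * G)\<^sup>T = A * G \<and> (G * A)\<^sup>T = G * A"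

definition mp_inverse :: "real mat \<Rightarrow> real mat" where
  "mp_inverse A = (THE G. is_mp_inverse A G)"

lemma is_mp_inverse_unique:
  assumes "is_mp_inverse A G" "is_mp_inverse A H"
  shows "G = H"
proof -
  define m n where "m = dim_row A" and "n = dim_col A"
  have A: "A \<in> carrier_mat m n" by (simp add: m_def n_def)
  have G: "G \<in> carrier_mat n m" and H: "H \<in> carrier_mat n m"
    using assms by (simp_all add: is_mp_inverse_def m_def n_def)
  have AG: "A * G \<in> carrier_mat m m" and AH: "A * H \<in> carrier_mat m m"
    and GA: "G * A \<in> carrier_mat n n" and HA: "H * A \<in> carrier_mat n n"
    using A G H by auto
  have "A * G = (A * H * A) * G"
    using assms by (simp add: is_mp_inverse_def)
  also have "\<dots> = (A * H) * (A * G)"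
    by (rule assoc_mult_mat[OF AH A G])
  also have "\<dots> = ((A * G) * (A * H))\<^sup>T"
    using assms transpose_mult[OF AG AH] by (simp add: is_mp_inverse_def)
  also have "(A * G) * (A * H) = (A * G * A) * H"
    by (rule assoc_mult_mat[OF AG A H, symmetric])
  finally have eq1: "A * G = A * H"
    using assms by (simp add: is_mp_inverse_def)
  have "G * A = G * (A * H * A)"
    using assms by (simp add: is_mp_inverse_def)
  also have "\<dots> = G * (A * (H * A))"
    using assoc_mult_mat[OF A H A] by simp
  also have "\<dots> = (G * A) * (H * A)"
    by (rule assoc_mult_mat[OF G A HA, symmetric])
  also have "\<dots> = ((H * A) * (G * A))\<^sup>T"
    using assms transpose_mult[OF HA GA] by (simp add: is_mp_inverse_def)
  also have "(H * A) * (G * A) = H * (A * (G * A))"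
    by (rule assoc_mult_mat[OF H A GA])
  also have "A * (G * A) = A"
    using assoc_mult_mat[OF A G A] assms by (simp add: is_mp_inverse_def)
  finally have eq2: "G * A = H * A"
    using assms by (simp add: is_mp_inverse_def)
  have "G = (G * A) * G" using assms by (simp add: is_mp_inverse_def)
  also have "\<dots> = H * (A * G)" unfolding eq2 by (rule assoc_mult_mat[OF H A G])
  also have "\<dots> = H * A * H" unfolding eq1 by (rule assoc_mult_mat[OF H A H, symmetric])
  also have "\<dots> = H" using assms by (simp add: is_mp_inverse_def)
  finally show ?thesis .
qed

lemma mp_inverse_eqI: "is_mp_inverse A G \<Longrightarrow> mp_inverse A = G"
  unfolding mp_inverse_def by (blast intro: the_equality is_mp_inverse_unique)

(* In the next two definitions J stands for a generalized inverse of L^T L. *)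

definition proj_mat :: "real mat \<Rightarrow> real mat \<Rightarrow> real mat" where
  "proj_mat L J = L * J * L\<^sup>T"

definition info_matrix :: "real mat \<Rightarrow> real mat \<Rightarrow> real mat \<Rightarrow> real mat" where
  "info_matrix L J X = X\<^sup>T * (1\<^sub>m (dim_row L) - proj_mat L J) * X"

text \<open>The design enters through its information matrix \<open>C\<close>.\<close>

definition feasible :: "real mat \<Rightarrow> real mat \<Rightarrow> bool" where
  "feasible C Q \<longleftrightarrow> column_space Q \<subseteq> column_space C"

(* G stands for a generalized inverse of the information matrix of the design. *)
definition info_matrix_for :: "real mat \<Rightarrow> real mat \<Rightarrow> real mat" where
  "info_matrix_for Q G = mp_inverse (Q\<^sup>T * G * Q)"

definition spectral_decomp :: "real mat \<Rightarrow> real mat \<Rightarrow> (nat \<Rightarrow> real) \<Rightarrow> bool" where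
  "spectral_decomp W S lam \<longleftrightarrow>
     S \<in> carrier_mat (dim_row W) (dim_row W) \<and>
     S\<^sup>T * S = 1\<^sub>m (dim_row W) \<and> S * S\<^sup>T = 1\<^sub>m (dim_row W) \<and>
     (\<forall>i j. i \<le> j \<longrightarrow> j < dim_row W \<longrightarrow> lam j \<le> lam i) \<and>
     W = S * mat_diag (dim_row W) lam * S\<^sup>T"

(* Depends on the chosen spectral decomposition (S, lam) of W, which is not unique. *)
definition K_mat :: "real mat \<Rightarrow> real mat \<Rightarrow> (nat \<Rightarrow> real) \<Rightarrow> real mat" where
  "K_mat W S lam =
     (let v = dim_row W; d = vec_space.rank v W;
          F = mat v d (\<lambda>(i, j). S $$ (i, j))
      in F * mat_diag d (\<lambda>j. sqrt (lam j)))"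

(* mat_inverse is option-valued: it returns None for a singular matrix. *)
definition weighted_info_matrix :: "real mat \<Rightarrow> real mat \<Rightarrow> real mat" where
  "weighted_info_matrix K G = the (mat_inverse (K\<^sup>T * G * K))"

(* Each eigenvalue occurs with its multiplicity as a root of the characteristic polynomial.
   For real symmetric matrices this is also its geometric multiplicity, and no
   eigenvalue is lost by counting real roots only. *)
definition nonzero_eigenvalues :: "real mat \<Rightarrow> real multiset" where
  "nonzero_eigenvalues A = filter_mset (\<lambda>x. x \<noteq> 0) (proots (char_poly A))"

end

theory Submission
  imports Defs
begin

text \<open>
  Write \<open>C = M\<^sup>T * M\<close> for the information matrix of the design, \<open>K\<close> for \<open>K_mat (Q * Q\<^sup>T) S lam\<close>, and
  \<open>D\<close> for the invertible diagonal matrix \<open>K\<^sup>T * K\<close>. Since \<open>K * K\<^sup>T = Q * Q\<^sup>T\<close>, the matrix \<open>U = Q\<^sup>T * K * D\<^sup>-\<^sup>1\<close>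
  has orthonormal columns and satisfies \<open>K = Q * U\<close> and \<open>Q = K * U\<^sup>T\<close>. Hence \<open>Q\<^sup>T * C\<^sup>- * Q = U * A * U\<^sup>T\<close> with
  \<open>A = K\<^sup>T * C\<^sup>- * K\<close> invertible, so the Moore-Penrose inverse of the former is \<open>U * A\<^sup>-\<^sup>1 * U\<^sup>T\<close>. It has the
  same non-zero eigenvalues as \<open>A\<^sup>-\<^sup>1 * U\<^sup>T * U = A\<^sup>-\<^sup>1\<close>.
\<close>

section \<open>Matrix algebra and vanishing Gram matrices\<close>

text \<open>The premises are equations between dimensions rather than carrier memberships, so the
  simplifier can discharge them and use the lemma as a rewrite rule.\<close>

lemma mult_mat_assoc_dim:
  "dim_col A = dim_row B \<Longrightarrow> dim_col B = dim_row C \<Longrightarrow> A * B * C = A * (B * C)"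
  by (rule assoc_mult_mat[of A "dim_row A" "dim_row B" B "dim_row C" C "dim_col C"])
    (auto intro!: carrier_matI)

lemma transpose_mult_dim:
  fixes A B :: "'a :: comm_semiring_0 mat"
  shows "dim_col A = dim_row B \<Longrightarrow> (A * B)\<^sup>T = B\<^sup>T * A\<^sup>T"
  by (rule transpose_mult[of A "dim_row A" "dim_row B" B "dim_col B"]) (auto intro!: carrier_matI)

lemma mult_mat_zero_vec: "A \<in> carrier_mat m n \<Longrightarrow> A *\<^sub>v 0\<^sub>v n = 0\<^sub>v m"
  by (intro eq_vecI) auto

text \<open>Each diagonal entry of \<open>A * A\<^sup>T\<close> is the sum of squares of a row of
  \<open>A\<close>.\<close>

lemma mult_transpose_eq_0:
  fixes A :: "real mat"
  assumes A: "A \<in> carrier_mat m n" and 0: "A * A\<^sup>T = 0\<^sub>m m m"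
  shows "A = 0\<^sub>m m n"
proof (rule eq_matI)
  fix i j assume ij: "i < dim_row (0\<^sub>m m n)" "j < dim_col (0\<^sub>m m n :: real mat)"
  have "(\<Sum>k = 0..<n. A $$ (i, k) * A $$ (i, k)) = (A * A\<^sup>T) $$ (i, i)"
    using A ij by (simp add: scalar_prod_def)
  then have "(\<Sum>k = 0..<n. A $$ (i, k) * A $$ (i, k)) = 0"
    using 0 ij by simp
  then have "A $$ (i, j) * A $$ (i, j) = 0"
    using ij by (subst (asm) sum_nonneg_eq_0_iff) auto
  then show "A $$ (i, j) = 0\<^sub>m m n $$ (i, j)" using ij by simp
qed (use A in auto)

lemma transpose_mult_eq_0:
  fixes A :: "real mat"
  assumes A: "A \<in> carrier_mat m n" and 0: "A\<^sup>T * A = 0\<^sub>m n n"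
  shows "A = 0\<^sub>m m n"
proof -
  have "A\<^sup>T = 0\<^sub>m n m"
    by (rule mult_transpose_eq_0) (use A 0 in auto)
  then have "(A\<^sup>T)\<^sup>T = (0\<^sub>m n m)\<^sup>T" by simp
  then show ?thesis by simp
qed

text \<open>The scalar product of \<open>x\<close> with \<open>N\<^sup>T * N *\<^sub>v x\<close> is
  the squared length of \<open>N *\<^sub>v x\<close>.\<close>

lemma transpose_mult_self_vec_eq_0:
  fixes N :: "real mat"
  assumes N: "N \<in> carrier_mat m d" and x: "x \<in> carrier_vec d"
    and 0: "N\<^sup>T * N *\<^sub>v x = 0\<^sub>v d"
  shows "N *\<^sub>v x = 0\<^sub>v m"
proof (rule eq_vecI)
  have w: "N *\<^sub>v x \<in> carrier_vec m" using N x by simp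
  have "(N *\<^sub>v x) \<bullet> (N *\<^sub>v x) = x \<bullet> (N\<^sup>T *\<^sub>v (N *\<^sub>v x))"
    using transpose_vec_mult_scalar[OF N x w] comm_scalar_prod[OF x, of "N\<^sup>T *\<^sub>v (N *\<^sub>v x)"] N w
    by simp
  also have "\<dots> = 0"
    using 0 N x by (subst assoc_mult_mat_vec[symmetric, of _ d m]) auto
  finally have "(\<Sum>k = 0..<m. (N *\<^sub>v x) $ k * (N *\<^sub>v x) $ k) = 0"
    using N by (simp add: scalar_prod_def)
  then show "(N *\<^sub>v x) $ i = 0\<^sub>v m $ i" if "i < dim_vec (0\<^sub>v m :: real vec)" for i
    using that by (subst (asm) sum_nonneg_eq_0_iff) auto
qed (use N in auto)

section \<open>Characteristic polynomials and non-zero eigenvalues of \<open>A * B\<close> and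
  \<open>B * A\<close>\<close>

lemma char_poly_four_block_upper_right_zero:
  fixes A D :: "'a :: idom mat"
  assumes A: "A \<in> carrier_mat m m" and C: "C \<in> carrier_mat n m" and D: "D \<in> carrier_mat n n"
  shows "char_poly (four_block_mat A (0\<^sub>m m n) C D) = char_poly A * char_poly D"
proof -
  have "char_poly_matrix (four_block_mat A (0\<^sub>m m n) C D) =
      four_block_mat (char_poly_matrix A) (0\<^sub>m m n) (map_mat (\<lambda>a. [:- a:]) C) (char_poly_matrix D)"
    unfolding char_poly_matrix_def using A C D by (intro eq_matI) (auto simp: one_poly_def)
  then show ?thesis
    unfolding char_poly_def
    using det_four_block_mat_upper_right_zero[of "char_poly_matrix A" m _ n _ "char_poly_matrix D"] A C D
    by simp
qed

text \<open>Conjugation by the unipotent block matrix \<open>?P\<close>, with inverse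
  \<open>?R\<close>, turns \<open>?N\<close> into \<open>?M\<close>. Both are block lower
  triangular, so their characteristic polynomials factor over the diagonal blocks. The zero blocks
  compensate for the different sizes of the two products.\<close>

lemma char_poly_mult_swap:
  fixes A B :: "'a :: idom mat"
  assumes A: "A \<in> carrier_mat m n" and B: "B \<in> carrier_mat n m"
  shows "char_poly (A * B) * char_poly (0\<^sub>m n n) = char_poly (0\<^sub>m m m) * char_poly (B * A)"
proof -
  let ?M = "four_block_mat (A * B) (0\<^sub>m m n) B (0\<^sub>m n n)"
  let ?N = "four_block_mat (0\<^sub>m m m) (0\<^sub>m m n) B (B * A)"
  let ?P = "four_block_mat (1\<^sub>m m) A (0\<^sub>m n m) (1\<^sub>m n)"
  let ?R = "four_block_mat (1\<^sub>m m) (- A) (0\<^sub>m n m) (1\<^sub>m n)"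
  have inv: "A + - A = 0\<^sub>m m n" "- A + A = 0\<^sub>m m n" "- 0\<^sub>m n n + 1\<^sub>m n = (1\<^sub>m n :: 'a mat)"
    using A by (auto intro!: eq_matI)
  have PR: "?P * ?R = 1\<^sub>m (m + n)" "?R * ?P = 1\<^sub>m (m + n)"
    using A by (subst mult_four_block_mat[of _ m m _ n _ n _ _ m _ n]; simp add: inv)+
  have PN: "?P * ?N = four_block_mat (A * B) (A * B * A) B (B * A)"
    using A B
    by (subst mult_four_block_mat[of _ m m _ n _ n _ _ m _ n]) (auto simp: mult_mat_assoc_dim)
  have "?P * ?N * ?R = ?M"
    unfolding PN using A B
    by (subst mult_four_block_mat[of _ m m _ n _ n _ _ m _ n])
      (auto simp: mult_mat_assoc_dim)
  then have "similar_mat ?M ?N"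
    using A B PR by (intro similar_matI[of _ _ ?P ?R "m + n"]) auto
  then have "char_poly ?M = char_poly ?N" by (rule char_poly_similar)
  then show ?thesis
    using A B char_poly_four_block_upper_right_zero[of "A * B" m B n "0\<^sub>m n n"]
      char_poly_four_block_upper_right_zero[of "0\<^sub>m m m" m B n "B * A"]
    by simp
qed

text \<open>Monic polynomials are non-zero; this is required because \<open>proots\<close> is
  additive over products of non-zero factors.\<close>

lemma char_poly_neq_0: "A \<in> carrier_mat n n \<Longrightarrow> char_poly A \<noteq> 0"
  using degree_monic_char_poly[of A n] by force

text \<open>The extra factors in \<open>char_poly_mult_swap\<close> are powers of the indeterminate.
  They contribute only the root 0, which the filter discards.\<close>

lemma nonzero_eigenvalues_mult_swap:
  assumes A: "A \<in> carrier_mat m n" and B: "B \<in> carrier_mat n m"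
  shows "nonzero_eigenvalues (A * B) = nonzero_eigenvalues (B * A)"
proof -
  have 0: "nonzero_eigenvalues (0\<^sub>m k k) = {#}" for k
  proof -
    have "map (\<lambda>a. [:- a, 1:]) (diag_mat (0\<^sub>m k k :: real mat)) = replicate k [:0, 1:]"
      by (rule nth_equalityI) (auto simp: diag_mat_def)
    then have "char_poly (0\<^sub>m k k :: real mat) = [:0, 1:] ^ k"
      by (subst char_poly_upper_triangular[of _ k]) auto
    then show ?thesis
      by (intro multiset_eqI) (simp add: nonzero_eigenvalues_def proots_power)
  qed
  have "proots (char_poly (A * B)) + proots (char_poly (0\<^sub>m n n)) =
      proots (char_poly (0\<^sub>m m m)) + proots (char_poly (B * A))"
    using char_poly_mult_swap[OF A B] A B
      char_poly_neq_0[of "A * B" m] char_poly_neq_0[of "B * A" n]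
      char_poly_neq_0[of "0\<^sub>m n n :: real mat" n] char_poly_neq_0[of "0\<^sub>m m m :: real mat" m]
    by (metis proots_mult mult_carrier_mat zero_carrier_mat mult_eq_0_iff)
  then have "nonzero_eigenvalues (A * B) + nonzero_eigenvalues (0\<^sub>m n n) =
      nonzero_eigenvalues (0\<^sub>m m m) + nonzero_eigenvalues (B * A)"
    unfolding nonzero_eigenvalues_def by (metis filter_union_mset)
  then show ?thesis by (simp add: 0)
qed

section \<open>Column spaces, factorization and rank\<close>

lemma (in vec_space) col_space_mult_subset:
  assumes A: "A \<in> carrier_mat n k" and B: "B \<in> carrier_mat k m"
  shows "col_space (A * B) \<subseteq> col_space A"
proof -
  have AB: "A * B \<in> carrier_mat n m" using A B by simp
  show ?thesis
    unfolding col_space_eq[OF A] col_space_eq[OF AB]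
    using A B by (auto intro!: exI[of _ "B *\<^sub>v _"])
qed

text \<open>Each column of \<open>A\<close> has a preimage under \<open>B\<close>; these preimages
  are the columns of \<open>R\<close>.\<close>

lemma (in vec_space) col_space_subset_imp_factor:
  assumes A: "A \<in> carrier_mat n k" and B: "B \<in> carrier_mat n m"
    and sub: "col_space A \<subseteq> col_space B"
  obtains R where "R \<in> carrier_mat m k" "A = B * R"
proof -
  have "\<exists>x \<in> carrier_vec m. B *\<^sub>v x = col A j" if "j < k" for j
  proof -
    have "col A j \<in> col_space A"
      unfolding col_space_def
      by (rule span_mem) (use A that in \<open>auto simp: cols_def\<close>)
    then show ?thesis using sub B unfolding col_space_eq[OF B] by auto
  qed
  then obtain x where x: "\<And>j. j < k \<Longrightarrow> x j \<in> carrier_vec m \<and> B *\<^sub>v x j = col A j"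
    by metis
  let ?R = "mat m k (\<lambda>(i, j). x j $ i)"
  have "A = B * ?R"
  proof (rule eq_matI)
    fix i j assume ij: "i < dim_row (B * ?R)" "j < dim_col (B * ?R)"
    have "col ?R j = x j" using ij x[of j] by (auto simp: col_def)
    then have "(B * ?R) $$ (i, j) = (B *\<^sub>v x j) $ i" using ij by simp
    then show "A $$ (i, j) = (B * ?R) $$ (i, j)" using ij x[of j] A B by simp
  qed (use A B in auto)
  then show thesis using that[of ?R] by simp
qed

lemma (in vec_space) rank_left_invertible:
  assumes A: "A \<in> carrier_mat n r" and B: "B \<in> carrier_mat r n" and BA: "B * A = 1\<^sub>m r"
  shows "rank A = r"
proof (rule lin_indpt_full_rank[OF A])
  \<comment> \<open>Linear independence is a property of the set of columns, so repeated columns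
    have to be excluded separately.\<close>
  have eq: "i = j" if ij: "i < r" "j < r" and c: "col A i = col A j" for i j
  proof -
    have "(B * A) $$ (j, i) = (B * A) $$ (j, j)" using ij c A B by simp
    then show ?thesis using ij unfolding BA by (simp split: if_splits)
  qed
  show dist: "distinct (cols A)"
    unfolding distinct_conv_nth using A eq by auto
  show "lin_indpt (set (cols A))"
  proof
    assume "lin_dep (set (cols A))"
    then obtain x where x: "x \<in> carrier_vec r" "x \<noteq> 0\<^sub>v r" "A *\<^sub>v x = 0\<^sub>v n"
      using lin_depE[OF A _ dist] by blast
    have "x = B *\<^sub>v (A *\<^sub>v x)"
      using x BA assoc_mult_mat_vec[OF B A, of x] by simp
    also have "\<dots> = 0\<^sub>v r" unfolding x(3) by (rule mult_mat_zero_vec[OF B])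
    finally show False using x by simp
  qed
qed

lemma (in vec_space) rank_cong_col_space:
  "col_space A = col_space B \<Longrightarrow> rank A = rank B"
  unfolding rank_def col_space_def by simp

section \<open>Spectral decomposition and the factor \<open>K_mat\<close>\<close>

lemma mat_diag_inverse:
  fixes f :: "nat \<Rightarrow> real"
  assumes "\<And>j. j < d \<Longrightarrow> f j \<noteq> 0"
  shows "mat_diag d f * mat_diag d (\<lambda>j. inverse (f j)) = 1\<^sub>m d"
    "mat_diag d (\<lambda>j. inverse (f j)) * mat_diag d f = 1\<^sub>m d"
  unfolding mat_diag_diag using assms by (auto simp: mat_diag_def intro!: eq_matI)

lemma transpose_mat_diag: "(mat_diag d f)\<^sup>T = mat_diag d f"
  by (auto simp: mat_diag_def intro!: eq_matI)

text \<open>Conjugating by \<open>S\<close> shows that the diagonal matrix of eigenvalues is itself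
  the Gram matrix of the rows of \<open>S\<^sup>T * Q\<close>.\<close>

lemma spectral_decomp_gram_nonneg:
  assumes Q: "Q \<in> carrier_mat v s" and S: "spectral_decomp (Q * Q\<^sup>T) S lam" and j: "j < v"
  shows "lam j \<ge> 0"
proof -
  have Sc: "S \<in> carrier_mat v v" and SS: "S\<^sup>T * S = 1\<^sub>m v"
    and W: "Q * Q\<^sup>T = S * mat_diag v lam * S\<^sup>T"
    using S Q by (auto simp: spectral_decomp_def)
  have D: "mat_diag v lam \<in> carrier_mat v v" by simp
  have "(S\<^sup>T * Q) * (S\<^sup>T * Q)\<^sup>T = S\<^sup>T * (Q * Q\<^sup>T) * S"
    using Q Sc by (simp add: mult_mat_assoc_dim transpose_mult_dim)
  also have "\<dots> = (S\<^sup>T * S) * mat_diag v lam * (S\<^sup>T * S)"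
    unfolding W using Sc carrier_matD[OF D] by (simp add: mult_mat_assoc_dim)
  also have "\<dots> = mat_diag v lam"
    unfolding SS by (simp only: left_mult_one_mat[OF D] right_mult_one_mat[OF D])
  finally have "lam j = ((S\<^sup>T * Q) * (S\<^sup>T * Q)\<^sup>T) $$ (j, j)"
    using j by (simp add: mat_diag_def)
  also have "\<dots> = (\<Sum>k = 0..<s. (S\<^sup>T * Q) $$ (j, k) * (S\<^sup>T * Q) $$ (j, k))"
    using Sc Q j by (simp add: scalar_prod_def)
  also have "\<dots> \<ge> 0" by (intro sum_nonneg) simp
  finally show ?thesis .
qed

text \<open>\<open>K_mat\<close> keeps as many columns as the rank of the weight matrix. The point
  is that this rank equals the number of positive eigenvalues, so that exactly the zero eigenvalues
  are cut off.\<close>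

lemma K_mat_gram:
  assumes Q: "Q \<in> carrier_mat v s" and S: "spectral_decomp (Q * Q\<^sup>T) S lam"
  defines "K \<equiv> K_mat (Q * Q\<^sup>T) S lam"
  obtains d where "K \<in> carrier_mat v d" "K * K\<^sup>T = Q * Q\<^sup>T" "K\<^sup>T * K = mat_diag d lam"
    "\<And>j. j < d \<Longrightarrow> lam j > 0"
proof -
  interpret vec_space "TYPE(real)" v .
  have Sc: "S \<in> carrier_mat v v" and SS: "S\<^sup>T * S = 1\<^sub>m v"
    and W: "Q * Q\<^sup>T = S * mat_diag v lam * S\<^sup>T"
    and mono: "\<And>i j. i \<le> j \<Longrightarrow> j < v \<Longrightarrow> lam j \<le> lam i"
    using S Q by (auto simp: spectral_decomp_def)
  have nonneg: "lam j \<ge> 0" if "j < v" for j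
    using spectral_decomp_gram_nonneg[OF Q S that] .
  \<comment> \<open>By monotonicity the positive eigenvalues are those with index below
    \<open>r\<close>. The disjunct \<open>j \<ge> v\<close> makes \<open>r\<close> well defined, and
    at most \<open>v\<close>, when no eigenvalue vanishes.\<close>
  define r where "r = (LEAST j. j \<ge> v \<or> lam j = 0)"
  have r_prop: "r \<ge> v \<or> lam r = 0"
    unfolding r_def by (rule LeastI[of _ v]) simp
  have rv: "r \<le> v"
    unfolding r_def by (rule Least_le) simp
  have pos: "lam j > 0" if "j < r" for j
    using not_less_Least[of j "\<lambda>j. j \<ge> v \<or> lam j = 0"] that nonneg[of j] rv
    unfolding r_def[symmetric] by auto
  have zero: "lam j = 0" if "r \<le> j" "j < v" for j
    using r_prop mono[of r j] nonneg[of j] that by auto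
  \<comment> \<open>This is \<open>K\<close> truncated at \<open>r\<close> instead of at the rank;
    the two coincide once the rank is known to be \<open>r\<close>.\<close>
  define Kr where "Kr = mat v r (\<lambda>(i, j). S $$ (i, j) * sqrt (lam j))"
  have Kr: "Kr \<in> carrier_mat v r" by (simp add: Kr_def)
  have KKT: "Kr * Kr\<^sup>T = Q * Q\<^sup>T"
  proof (rule eq_matI)
    fix i j assume "i < dim_row (Q * Q\<^sup>T)" "j < dim_col (Q * Q\<^sup>T)"
    then have ij: "i < v" "j < v" using Q by auto
    have "(Kr * Kr\<^sup>T) $$ (i, j) = (\<Sum>k = 0..<r. S $$ (i, k) * lam k * S $$ (j, k))"
      using ij pos by (auto simp: Kr_def scalar_prod_def less_imp_le intro!: sum.cong)
    also have "\<dots> = (\<Sum>k = 0..<v. S $$ (i, k) * lam k * S $$ (j, k))"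
      using rv zero by (intro sum.mono_neutral_left) auto
    also have "\<dots> = (Q * Q\<^sup>T) $$ (i, j)"
      unfolding W mat_diag_mult_right[OF Sc] using ij Sc by (simp add: scalar_prod_def)
    finally show "(Kr * Kr\<^sup>T) $$ (i, j) = (Q * Q\<^sup>T) $$ (i, j)" .
  qed (use Q Kr in auto)
  have KTK: "Kr\<^sup>T * Kr = mat_diag r lam"
  proof (rule eq_matI)
    fix i j assume "i < dim_row (mat_diag r lam)" "j < dim_col (mat_diag r lam)"
    then have ij: "i < r" "j < r" by (auto simp: mat_diag_def)
    have "(Kr\<^sup>T * Kr) $$ (i, j) =
        sqrt (lam i) * sqrt (lam j) * (\<Sum>k = 0..<v. S $$ (k, i) * S $$ (k, j))"
      unfolding sum_distrib_left
      using ij by (auto simp: Kr_def scalar_prod_def intro!: sum.cong)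
    also have "(\<Sum>k = 0..<v. S $$ (k, i) * S $$ (k, j)) = (S\<^sup>T * S) $$ (i, j)"
      using ij rv Sc by (simp add: scalar_prod_def)
    finally show "(Kr\<^sup>T * Kr) $$ (i, j) = mat_diag r lam $$ (i, j)"
      using ij rv pos[of i] unfolding SS by (auto simp: mat_diag_def)
  qed (auto simp: Kr_def mat_diag_def)
  define Di where "Di = mat_diag r (\<lambda>j. inverse (lam j))"
  have Di: "Di \<in> carrier_mat r r" by (simp add: Di_def)
  have DiD: "Di * mat_diag r lam = 1\<^sub>m r" "mat_diag r lam * Di = 1\<^sub>m r"
    unfolding Di_def by (rule mat_diag_inverse, use pos in force)+
  have "(Di * Kr\<^sup>T) * Kr = 1\<^sub>m r"
    using Kr Di KTK DiD by (simp add: mult_mat_assoc_dim)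
  then have "rank Kr = r"
    using rank_left_invertible[OF Kr, of "Di * Kr\<^sup>T"] Kr Di by simp
  moreover have "col_space (Q * Q\<^sup>T) = col_space Kr"
  proof
    show "col_space (Q * Q\<^sup>T) \<subseteq> col_space Kr"
      unfolding KKT[symmetric] by (rule col_space_mult_subset) (use Kr in auto)
    \<comment> \<open>Multiplying \<open>Kr\<close> by its own Gram matrix rescales its columns by
      the eigenvalues, and \<open>Di\<close> undoes the scaling.\<close>
    have "Kr = (Q * Q\<^sup>T) * (Kr * Di)"
    proof -
      have "(Q * Q\<^sup>T) * (Kr * Di) = Kr * (Kr\<^sup>T * Kr) * Di"
        unfolding KKT[symmetric] using Kr Di by (simp add: mult_mat_assoc_dim)
      also have "\<dots> = Kr * (mat_diag r lam * Di)"
        unfolding KTK by (rule assoc_mult_mat[OF Kr _ Di]) simp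
      finally show ?thesis using DiD Kr by simp
    qed
    then show "col_space Kr \<subseteq> col_space (Q * Q\<^sup>T)"
      using col_space_mult_subset[of "Q * Q\<^sup>T" v "Kr * Di" r] Q Kr Di by simp
  qed
  ultimately have "rank (Q * Q\<^sup>T) = r" using rank_cong_col_space by metis
  then have "K = Kr"
    unfolding K_def K_mat_def Let_def Kr_def using Q rv
    by (subst mat_diag_mult_right[of _ v]) (auto intro!: eq_matI)
  then show thesis using that[of r] Kr KKT KTK pos by simp
qed

section \<open>The projector and the information matrix as a Gram matrix\<close>

text \<open>The residual \<open>?Z\<close> is annihilated by \<open>L\<^sup>T\<close>, yet its
  columns lie in the column space of \<open>L\<close>. Hence it is orthogonal to itself and
  vanishes.\<close>

lemma ginv_gram_absorb:
  assumes L: "L \<in> carrier_mat n m" and J: "is_ginv (L\<^sup>T * L) J"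
  shows "L * J * L\<^sup>T * L = L"
proof -
  have Jc: "J \<in> carrier_mat m m" and LJL: "L\<^sup>T * L * J * (L\<^sup>T * L) = L\<^sup>T * L"
    using J L by (auto simp: is_ginv_def)
  let ?P = "L * J * L\<^sup>T"
  let ?Z = "?P * L - L"
  have PL: "?P * L \<in> carrier_mat n m" using L Jc by (intro carrier_matI) auto
  have "L\<^sup>T * (?P * L) = L\<^sup>T * L"
    using LJL L Jc by (simp add: mult_mat_assoc_dim)
  then have 0: "L\<^sup>T * ?Z = 0\<^sub>m m m"
    using L PL mult_minus_distrib_mat[of "L\<^sup>T" m n "?P * L" m L] by simp
  have Zc: "?Z \<in> carrier_mat n m" using L by auto
  have Z: "?Z = L * (J * L\<^sup>T * L - 1\<^sub>m m)"
    using L Jc mult_minus_distrib_mat[of L n m "J * L\<^sup>T * L" m "1\<^sub>m m"]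
    by (simp add: mult_mat_assoc_dim)
  have "?Z\<^sup>T * ?Z = (J * L\<^sup>T * L - 1\<^sub>m m)\<^sup>T * (L\<^sup>T * ?Z)"
    using L Jc by (subst Z) (simp add: mult_mat_assoc_dim transpose_mult_dim)
  also have "\<dots> = 0\<^sub>m m m"
    unfolding 0 using L Jc by simp
  finally have "?Z = 0\<^sub>m n m"
    by (rule transpose_mult_eq_0[OF Zc])
  then show ?thesis
    using L PL by (auto simp: mat_eq_iff)
qed

text \<open>\<open>J\<close> need not be symmetric. Still \<open>P * L = L\<close> gives \<open>P * P\<^sup>T = P\<^sup>T\<close>, whose left-hand side is symmetric.\<close>

lemma proj_mat_symmetric_idempotent:
  assumes L: "L \<in> carrier_mat n m" and J: "is_ginv (L\<^sup>T * L) J"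
  shows "proj_mat L J \<in> carrier_mat n n"
    "(proj_mat L J)\<^sup>T = proj_mat L J"
    "proj_mat L J * proj_mat L J = proj_mat L J"
proof -
  let ?P = "proj_mat L J"
  have Jc: "J \<in> carrier_mat m m" using J L by (auto simp: is_ginv_def)
  show P: "?P \<in> carrier_mat n n" using L Jc by (simp add: proj_mat_def)
  have PT: "?P\<^sup>T = L * J\<^sup>T * L\<^sup>T"
    using L Jc by (simp add: proj_mat_def mult_mat_assoc_dim transpose_mult_dim)
  have PL: "?P * L = L" using ginv_gram_absorb[OF L J] by (simp add: proj_mat_def)
  have "?P * ?P\<^sup>T = (?P * L) * J\<^sup>T * L\<^sup>T"
    unfolding PT using L Jc P by (simp add: mult_mat_assoc_dim)
  then have PPT: "?P * ?P\<^sup>T = ?P\<^sup>T" unfolding PL PT .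
  have "(?P * ?P\<^sup>T)\<^sup>T = ?P * ?P\<^sup>T" using P by (simp add: transpose_mult_dim)
  then show sym: "?P\<^sup>T = ?P" unfolding PPT by simp
  show "?P * ?P = ?P" using PPT unfolding sym .
qed

text \<open>The complementary projector \<open>?R\<close> is symmetric and idempotent, so
  \<open>M = ?R * X\<close> works. This makes the non-negative definiteness of the information
  matrix explicit.\<close>

lemma info_matrix_gram:
  assumes L: "L \<in> carrier_mat n m" and J: "is_ginv (L\<^sup>T * L) J" and X: "X \<in> carrier_mat n v"
  obtains M where "M \<in> carrier_mat n v" "info_matrix L J X = M\<^sup>T * M"
proof -
  let ?P = "proj_mat L J"
  let ?R = "1\<^sub>m n - ?P"
  note P = proj_mat_symmetric_idempotent[OF L J]
  have R: "?R \<in> carrier_mat n n" using P(1) by auto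
  have RT: "?R\<^sup>T = ?R"
    using P by (simp add: transpose_minus[of _ n n])
  have "?R * ?R = 1\<^sub>m n * ?R - ?P * ?R"
    by (rule minus_mult_distrib_mat[of _ n n]) (use P R in auto)
  also have "?P * ?R = ?P * 1\<^sub>m n - ?P * ?P"
    by (rule mult_minus_distrib_mat[of _ n n]) (use P R in auto)
  also have "\<dots> = 0\<^sub>m n n" using P by simp
  finally have RR: "?R * ?R = ?R" using R P by (auto intro!: eq_matI)
  have "info_matrix L J X = X\<^sup>T * (?R\<^sup>T * ?R) * X"
    unfolding RT RR info_matrix_def using L by simp
  also have "\<dots> = (?R * X)\<^sup>T * (?R * X)"
    using R X P(1) by (simp only: mult_mat_assoc_dim transpose_mult_dim index_mult_mat
      index_transpose_mat index_minus_mat carrier_matD)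
  finally show thesis using that[of "?R * X"] R X by simp
qed

text \<open>Two copies of the symmetric matrix \<open>M\<^sup>T * M\<close> surround
  \<open>G\<close> and absorb it. As the result does not mention \<open>G\<close>, the left-hand
  side is independent of the choice of generalized inverse.\<close>

lemma transpose_mult_ginv_mult:
  assumes M: "M \<in> carrier_mat n v" and G: "is_ginv (M\<^sup>T * M) G"
    and R: "R \<in> carrier_mat v s" and A: "A = M\<^sup>T * M * R"
  shows "A\<^sup>T * G * A = (M * R)\<^sup>T * (M * R)"
proof -
  have Gc: "G \<in> carrier_mat v v" and MGM: "M\<^sup>T * M * G * (M\<^sup>T * M) = M\<^sup>T * M"
    using G M by (auto simp: is_ginv_def)
  have "A\<^sup>T * G * A = R\<^sup>T * (M\<^sup>T * M * G * (M\<^sup>T * M)) * R"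
    unfolding A using M R Gc by (simp add: mult_mat_assoc_dim transpose_mult_dim)
  also have "\<dots> = (M * R)\<^sup>T * (M * R)"
    unfolding MGM using M R by (simp add: mult_mat_assoc_dim transpose_mult_dim)
  finally show ?thesis .
qed

section \<open>Isometries between Gram factors, and Moore-Penrose inverses\<close>

text \<open>Two factors of the same Gram matrix differ by an isometry. In the definition of
  \<open>U\<close>, the product \<open>K * Di\<close> is the transposed Moore-Penrose inverse of
  \<open>K\<close>, which has full column rank.\<close>

lemma gram_eq_imp_isometry:
  fixes Q K :: "real mat"
  assumes Q: "Q \<in> carrier_mat v s" and K: "K \<in> carrier_mat v d"
    and W: "K * K\<^sup>T = Q * Q\<^sup>T" and D: "K\<^sup>T * K = mat_diag d lam"
    and pos: "\<And>j. j < d \<Longrightarrow> lam j > 0"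
  obtains U where "U \<in> carrier_mat s d" "U\<^sup>T * U = 1\<^sub>m d" "K = Q * U" "Q = K * U\<^sup>T"
proof -
  define Di where "Di = mat_diag d (\<lambda>j. inverse (lam j))"
  have Di: "Di \<in> carrier_mat d d" by (simp add: Di_def)
  have DiT: "Di\<^sup>T = Di" by (simp add: Di_def transpose_mat_diag)
  have DDi: "K\<^sup>T * K * Di = 1\<^sub>m d" "Di * (K\<^sup>T * K) = 1\<^sub>m d"
    unfolding Di_def D by (rule mat_diag_inverse, use pos in force)+
  define U where "U = Q\<^sup>T * K * Di"
  have U: "U \<in> carrier_mat s d" using Q K Di by (simp add: U_def)
  have "Q * U = K * K\<^sup>T * K * Di"
    unfolding U_def W using Q K Di by (simp add: mult_mat_assoc_dim)
  also have "\<dots> = K * (K\<^sup>T * K * Di)" using K Di by (simp add: mult_mat_assoc_dim)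
  finally have QU: "Q * U = K" using DDi K by simp
  have "U\<^sup>T * U = Di * K\<^sup>T * (Q * U)"
    unfolding U_def using Q K Di DiT by (simp add: mult_mat_assoc_dim transpose_mult_dim)
  also have "\<dots> = Di * (K\<^sup>T * K)" unfolding QU using K Di by (simp add: mult_mat_assoc_dim)
  finally have UU: "U\<^sup>T * U = 1\<^sub>m d" using DDi by simp
  \<comment> \<open>Since \<open>?Z * U\<close> vanishes, \<open>?Z * ?Z\<^sup>T\<close> reduces to
    \<open>?Z * Q\<^sup>T\<close>, that is, to \<open>Q * Q\<^sup>T - K * K\<^sup>T\<close>, which
    is zero.\<close>
  let ?Z = "Q - K * U\<^sup>T"
  have KU: "K * U\<^sup>T \<in> carrier_mat v s" using K U by simp
  have Z: "?Z \<in> carrier_mat v s" using KU by (rule minus_carrier_mat)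
  have ZU: "?Z * U = 0\<^sub>m v d"
  proof -
    have "?Z * U = Q * U - K * U\<^sup>T * U"
      by (rule minus_mult_distrib_mat[OF Q KU U])
    also have "K * U\<^sup>T * U = K" using K U UU by (simp add: mult_mat_assoc_dim)
    finally show ?thesis using QU K by simp
  qed
  have "?Z * ?Z\<^sup>T = ?Z * (Q\<^sup>T - U * K\<^sup>T)"
    using Q K U KU by (simp add: transpose_minus[of _ v s] transpose_mult_dim)
  also have "\<dots> = ?Z * Q\<^sup>T - ?Z * (U * K\<^sup>T)"
    by (rule mult_minus_distrib_mat[OF Z]) (use Q K U in auto)
  also have "?Z * (U * K\<^sup>T) = ?Z * U * K\<^sup>T"
    by (rule assoc_mult_mat[OF Z U, symmetric]) (use K in auto)
  also have "\<dots> = 0\<^sub>m v v" unfolding ZU using K by simp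
  also have "?Z * Q\<^sup>T = Q * Q\<^sup>T - K * U\<^sup>T * Q\<^sup>T"
    by (rule minus_mult_distrib_mat[OF Q KU]) (use Q in auto)
  also have "K * U\<^sup>T * Q\<^sup>T = K * (Q * U)\<^sup>T"
    using Q K U by (simp add: mult_mat_assoc_dim transpose_mult_dim)
  also have "\<dots> = Q * Q\<^sup>T" unfolding QU W ..
  finally have "?Z * ?Z\<^sup>T = 0\<^sub>m v v" using Q by (auto intro!: eq_matI)
  then have "?Z = 0\<^sub>m v s" by (rule mult_transpose_eq_0[OF Z])
  then have "Q = K * U\<^sup>T" using Q KU by (auto simp: mat_eq_iff)
  then show thesis using that[of U] U UU QU by simp
qed

text \<open>Conjugation by an isometry is multiplicative, so the Penrose equations follow from those
  for \<open>A\<close> and \<open>B\<close>. Both mixed products become the symmetric projector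
  \<open>U * U\<^sup>T\<close>.\<close>

lemma is_mp_inverse_isometry:
  assumes U: "U \<in> carrier_mat s d" and UU: "U\<^sup>T * U = 1\<^sub>m d"
    and A: "A \<in> carrier_mat d d" and B: "B \<in> carrier_mat d d"
    and AB: "A * B = 1\<^sub>m d" and BA: "B * A = 1\<^sub>m d"
  shows "is_mp_inverse (U * A * U\<^sup>T) (U * B * U\<^sup>T)"
proof -
  have prod: "(U * E * U\<^sup>T) * (U * F * U\<^sup>T) = U * (E * F) * U\<^sup>T"
    if E: "E \<in> carrier_mat d d" and F: "F \<in> carrier_mat d d" for E F
  proof -
    have "(U * E * U\<^sup>T) * (U * F * U\<^sup>T) = U * E * (U\<^sup>T * U) * F * U\<^sup>T"
      using U E F by (simp add: mult_mat_assoc_dim)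
    then show ?thesis unfolding UU using U E F by (simp add: mult_mat_assoc_dim)
  qed
  have sym: "(U * 1\<^sub>m d * U\<^sup>T)\<^sup>T = U * 1\<^sub>m d * U\<^sup>T"
    using U by (simp add: transpose_mult_dim)
  show ?thesis
    unfolding is_mp_inverse_def prod[OF A B] prod[OF B A] AB BA
    using U A B prod[of "1\<^sub>m d" A] prod[of "1\<^sub>m d" B] sym by simp
qed

theorem theorem3:
  fixes n v m s :: nat
    and X :: "'design \<Rightarrow> real mat" and L Q G H J S :: "real mat"
    and designs :: "'design set" and \<xi> :: 'design
    and E :: "real vec set" and lam :: "nat \<Rightarrow> real"
  assumes X: "\<And>\<eta>. \<eta> \<in> designs \<Longrightarrow> X \<eta> \<in> carrier_mat n v"
    and L: "L \<in> carrier_mat n m"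
    and J: "is_ginv (L\<^sup>T * L) J"
    and E: "VectorSpace.subspace class_ring E (module_vec TYPE(real) v)"
    and estimation_space:
      "\<And>\<eta>. \<eta> \<in> designs \<Longrightarrow> column_space (info_matrix L J (X \<eta>)) = E"
    and Q: "Q \<in> carrier_mat v s" and Q_estimable: "column_space Q \<subseteq> E"
    and \<xi>: "\<xi> \<in> designs" and \<xi>_feasible: "feasible (info_matrix L J (X \<xi>)) Q"
    and G: "is_ginv (info_matrix L J (X \<xi>)) G"
    and H: "is_ginv (info_matrix L J (X \<xi>)) H"
    and K: "spectral_decomp (Q * Q\<^sup>T) S lam"
  shows "nonzero_eigenvalues (info_matrix_for Q G) =
         nonzero_eigenvalues (weighted_info_matrix (K_mat (Q * Q\<^sup>T) S lam) H)"
proof -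
  let ?C = "info_matrix L J (X \<xi>)"
  let ?K = "K_mat (Q * Q\<^sup>T) S lam"
  obtain M where M: "M \<in> carrier_mat n v" and C: "?C = M\<^sup>T * M"
    using info_matrix_gram[OF L J X[OF \<xi>]] .
  obtain d where Kc: "?K \<in> carrier_mat v d" and KKT: "?K * ?K\<^sup>T = Q * Q\<^sup>T"
    and KTK: "?K\<^sup>T * ?K = mat_diag d lam" and pos: "\<And>j. j < d \<Longrightarrow> lam j > 0"
    by (rule K_mat_gram[OF Q K]) blast
  obtain U where U: "U \<in> carrier_mat s d" and UU: "U\<^sup>T * U = 1\<^sub>m d"
    and KQ: "?K = Q * U" and QK: "Q = ?K * U\<^sup>T"
    by (rule gram_eq_imp_isometry[OF Q Kc KKT KTK pos])
  \<comment> \<open>Feasibility lets \<open>Q\<close> factor through the information matrix, and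
    \<open>K_mat\<close> inherits the factorization because it equals \<open>Q * U\<close>.\<close>
  obtain R where R: "R \<in> carrier_mat v s" and QR: "Q = M\<^sup>T * M * R"
    using vec_space.col_space_subset_imp_factor[OF Q, of "M\<^sup>T * M" v] \<xi>_feasible M Q
    unfolding feasible_def C by auto
  define T where "T = R * U"
  have T: "T \<in> carrier_mat v d" using R U by (simp add: T_def)
  have KT: "?K = M\<^sup>T * M * T"
    unfolding T_def using M R U by (subst KQ, subst QR) (simp add: mult_mat_assoc_dim)
  define A where "A = ?K\<^sup>T * H * ?K"
  have A: "A \<in> carrier_mat d d" unfolding A_def using Kc by (intro carrier_matI) auto
  \<comment> \<open>The two sides of the claim use different generalized inverses \<open>G\<close>
    and \<open>H\<close>; this form without either identifies them.\<close>
  have A_gram: "A = (M * T)\<^sup>T * (M * T)"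
    unfolding A_def by (rule transpose_mult_ginv_mult[OF M H[unfolded C] T KT])
  have A_G: "A = ?K\<^sup>T * G * ?K"
    unfolding A_gram by (rule transpose_mult_ginv_mult[OF M G[unfolded C] T KT, symmetric])
  have Gc: "G \<in> carrier_mat v v" using G M unfolding C is_ginv_def by simp
  \<comment> \<open>A kernel vector of \<open>A\<close> is killed by \<open>M * T\<close>, hence by
    \<open>?K = M\<^sup>T * (M * T)\<close>, whose Gram matrix \<open>?K\<^sup>T * ?K\<close> is
    diagonal with positive entries.\<close>
  have "det A \<noteq> 0"
  proof
    assume "det A = 0"
    then obtain x where x: "x \<in> carrier_vec d" "x \<noteq> 0\<^sub>v d" "A *\<^sub>v x = 0\<^sub>v d"
      using det_0_iff_vec_prod_zero_field[OF A] by blast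
    have "M * T *\<^sub>v x = 0\<^sub>v n"
      using transpose_mult_self_vec_eq_0[of "M * T" n d x] x M T unfolding A_gram by simp
    moreover have "?K *\<^sub>v x = M\<^sup>T *\<^sub>v (M * T *\<^sub>v x)"
      unfolding KT using M T x
      by (subst assoc_mult_mat_vec[symmetric, of _ v n]) (auto simp: mult_mat_assoc_dim)
    ultimately have "?K *\<^sub>v x = 0\<^sub>v v"
      using M mult_mat_zero_vec[of "M\<^sup>T" v n] by simp
    then have "mat_diag d lam *\<^sub>v x = 0\<^sub>v d"
      unfolding KTK[symmetric] using Kc x by (subst assoc_mult_mat_vec[of _ d v]) auto
    then have "mat_diag d (\<lambda>j. inverse (lam j)) * mat_diag d lam *\<^sub>v x = 0\<^sub>v d"
      using x by (subst assoc_mult_mat_vec[of _ d d]) (auto intro!: mult_mat_zero_vec)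
    moreover have "mat_diag d (\<lambda>j. inverse (lam j)) * mat_diag d lam = 1\<^sub>m d"
      by (rule mat_diag_inverse) (use pos in force)
    ultimately show False using x by simp
  qed
  then have "A \<in> Units (ring_mat TYPE(real) d ())"
    by (rule det_non_zero_imp_unit[OF A])
  \<comment> \<open>Invertibility excludes \<open>None\<close>, so \<open>the\<close> in
    \<open>weighted_info_matrix\<close> returns a genuine inverse.\<close>
  then obtain B where B_def: "mat_inverse A = Some B"
    using mat_inverse(1)[OF A, where b = "()"] by (cases "mat_inverse A") auto
  then have AB: "A * B = 1\<^sub>m d" "B * A = 1\<^sub>m d" and B: "B \<in> carrier_mat d d"
    using mat_inverse(2)[OF A] by auto
  have "Q\<^sup>T * G * Q = (?K * U\<^sup>T)\<^sup>T * G * (?K * U\<^sup>T)" using QK by simp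
  also have "\<dots> = U * A * U\<^sup>T"
    unfolding A_G using Kc U Gc by (simp add: mult_mat_assoc_dim transpose_mult_dim)
  finally have "info_matrix_for Q G = U * B * U\<^sup>T"
    unfolding info_matrix_for_def
    using mp_inverse_eqI[OF is_mp_inverse_isometry[OF U UU A B AB]] by simp
  also have "\<dots> = U * (B * U\<^sup>T)" using U B by (simp add: mult_mat_assoc_dim)
  finally have "nonzero_eigenvalues (info_matrix_for Q G) = nonzero_eigenvalues (B * U\<^sup>T * U)"
    using nonzero_eigenvalues_mult_swap[of U s d "B * U\<^sup>T"] U B by simp
  also have "B * U\<^sup>T * U = B" using U B UU by (simp add: mult_mat_assoc_dim)
  also have "B = weighted_info_matrix ?K H"
    using B_def unfolding A_def weighted_info_matrix_def by simp
  finally show ?thesis .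
qed

end
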